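(* For every integer $n\ge 6$, writing $k=\lfloor n/4\rfloor$, we have $\mathrm{co}^{+}\mathrm{ex}(n,C_5)=2k$ if $n\equiv 0,1,2 \pmod 4$, and $\mathrm{co}^{+}\mathrm{ex}(n,C_5)=2k+1$ if $n\equiv 3\pmod 4$.
   Context: A $3$-graph $H$ is a hypergraph all of whose edges have size $3$. For a $2$-set $S$ of vertices, its co-degree is the number of edges of $H$ containing $S$. The minimum positive co-degree $\delta_2^{+}(H)$ of a non-empty $3$-graph $H$ is the minimum co-degree over all $2$-sets $S$ whose co-degree is nonzero. For a $3$-graph $F$, the positive co-degree Turán number $\mathrm{co}^{+}\mathrm{ex}(n,F)$ is the maximum of $\delta_2^{+}(H)$ over all $n$-vertex non-empty $3$-graphs $H$ containing no copy of $F$. $C_5$ denotes the $3$-graph on vertices $a,b,c,d,e$ with edges $\{abc, bcd, cde, dea, eab\}$. *)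

theory Defs
  imports Main
begin

type_synonym 'a hypergraph = "'a set \<times> 'a set set"

abbreviation verts :: "'a hypergraph \<Rightarrow> 'a set" where
  "verts H \<equiv> fst H"

abbreviation edges :: "'a hypergraph \<Rightarrow> 'a set set" where
  "edges H \<equiv> snd H"

definition three_graph :: "'a hypergraph \<Rightarrow> bool" where
  "three_graph H \<longleftrightarrow> finite (verts H) \<and> (\<forall>e\<in>edges H. e \<subseteq> verts H \<and> card e = 3)"

definition codegree :: "'a hypergraph \<Rightarrow> 'a set \<Rightarrow> nat" where
  "codegree H S = card {e \<in> edges H. S \<subseteq> e}"

text \<open>Only meaningful if \<open>H\<close> has at least one edge.\<close>

definition min_pos_codegree :: "'a hypergraph \<Rightarrow> nat" where
  "min_pos_codegree H =
     Min {codegree H S | S. S \<subseteq> verts H \<and> card S = 2 \<and> codegree H S \<noteq> 0}"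

text \<open>A copy is a not necessarily induced subgraph.\<close>

definition contains_copy :: "'a hypergraph \<Rightarrow> 'b hypergraph \<Rightarrow> bool" where
  "contains_copy H F \<longleftrightarrow>
     (\<exists>f. inj_on f (verts F) \<and> f ` verts F \<subseteq> verts H \<and> (\<forall>e\<in>edges F. f ` e \<in> edges H))"

text \<open>Every 3-graph on \<open>n\<close> vertices is isomorphic to one whose vertices are natural numbers, so
  fixing the vertex type loses nothing.\<close>

definition pos_codegree_turan :: "nat \<Rightarrow> 'b hypergraph \<Rightarrow> nat" where
  "pos_codegree_turan n F =
     Max {min_pos_codegree H | H :: nat hypergraph.
            three_graph H \<and> card (verts H) = n \<and> edges H \<noteq> {} \<and> \<not> contains_copy H F}"

definition C5 :: "nat hypergraph" where
  "C5 = ({0, 1, 2, 3, 4}, {{0, 1, 2}, {1, 2, 3}, {2, 3, 4}, {3, 4, 0}, {4, 0, 1}})"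

end

theory Submission
  imports Defs
begin

text \<open>The lower bound is the balanced blow-up of the complete 3-graph on four vertices: every two
  vertices of a copy of \<open>C5\<close> lie in a common edge, so its five vertices would need five different
  parts.

  For the upper bound, suppose that all positive co-degrees of a \<open>C5\<close>-free 3-graph on \<open>n\<close> vertices
  are at least \<open>n/2\<close>. The three pairs of an edge have total co-degree above \<open>n\<close>, so there are three
  edges on four vertices. If no four vertices span all four triples, every vertex forms an
  edge with at most three of their six pairs, and one of them with at most two, contradicting the total
  \<open>3n\<close>. Hence there is a complete \<open>abcd\<close>. The link of a vertex \<open>v\<close> on \<open>abcd\<close> has no path with three
  edges, so it has at most three edges; averaging makes it always a triangle or a star and all six
  co-degrees equal to \<open>n/2\<close>. Counting neighbours of a star vertex shows that stars of a given
  \<open>abcd\<close> share their centre, say \<open>a\<close>. Finally, on the \<open>n/2\<close> common neighbours of \<open>a\<close> and \<open>b\<close>, the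
  relation ``\<open>abxy\<close> is complete'' is a disjoint union of balanced complete bipartite graphs
  without isolated vertices; so \<open>n/2\<close> is even.\<close>

section \<open>Parity of unions of balanced complete bipartite graphs\<close>

lemma even_card_balanced_bipartite:
  assumes "finite N"
    and sym: "\<And>x y. R x y \<Longrightarrow> R y x"
    and step: "\<And>x y z w. R x y \<Longrightarrow> R z y \<Longrightarrow> R x w \<Longrightarrow> R z w"
    and balanced: "\<And>x y. R x y \<Longrightarrow> card {w. R x w} = card {w. R y w}"
    and disj: "\<And>x y w. R x y \<Longrightarrow> R x w \<Longrightarrow> R y w \<Longrightarrow> False"
    and closed: "\<And>x w. x \<in> N \<Longrightarrow> R x w \<Longrightarrow> w \<in> N"
    and total: "\<And>x. x \<in> N \<Longrightarrow> \<exists>y. R x y"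
  shows "even (card N)"
  using assms(1) closed total
proof (induction N rule: finite_psubset_induct)
  case (psubset N)
  show ?case
  proof (cases "N = {}")
    case False
    then obtain x where x: "x \<in> N" by blast
    then obtain y where y: "R x y" using psubset.prems(2) by blast
    \<comment> \<open>The neighbourhoods of the adjacent vertices x and y are the two sides of one
      component: by \<open>step\<close> no edge joins the rest of N to them. They have equal size by
      \<open>balanced\<close>, so this component is split off and induction handles the
      rest.\<close>
    define A where "A = {w. R x w}"
    define B where "B = {w. R y w}"
    have "y \<in> N" using x y psubset.prems(1) by blast
    then have sub: "A \<subseteq> N" "B \<subseteq> N" using x psubset.prems(1) by (auto simp: A_def B_def)
    then have fin: "finite A" "finite B" using psubset.hyps finite_subset by auto
    have "A \<inter> B = {}" using disj y by (auto simp: A_def B_def)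
    then have evM: "even (card (A \<union> B))"
      using fin balanced[OF y] by (simp add: card_Un_disjoint A_def B_def)
    have "x \<in> B" using sym[OF y] by (simp add: B_def)
    have closed': "w \<in> N - (A \<union> B)" if "z \<in> N - (A \<union> B)" "R z w" for z w
    proof -
      have "w \<notin> A"
      proof
        assume "w \<in> A"
        then have "R y z" using step[of w x y z] sym y that(2) by (auto simp: A_def)
        then show False using that by (simp add: B_def)
      qed
      moreover have "w \<notin> B"
      proof
        assume "w \<in> B"
        then have "R x z" using step[of w y x z] sym y that(2) by (auto simp: B_def)
        then show False using that by (simp add: A_def)
      qed
      ultimately show ?thesis using that psubset.prems(1) by blast
    qed
    have "even (card (N - (A \<union> B)))"
    proof (rule psubset.IH)
      show "N - (A \<union> B) \<subset> N" using \<open>x \<in> B\<close> x by blast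
    qed (use closed' psubset.prems(2) in blast)+
    moreover have "card N = card (N - (A \<union> B)) + card (A \<union> B)"
      using sub fin psubset.hyps
      by (metis Un_least add.commute card_Diff_subset card_mono finite_UnI le_add_diff_inverse)
    ultimately show ?thesis using evM by simp
  qed simp
qed

section \<open>C5-free 3-graphs with large positive co-degrees\<close>

text \<open>A symmetric ternary relation replaces the set of edges, so that the vertices of an edge
  can be listed in any order. In \<open>dense\<close> the bound is doubled so that an odd
  \<open>card V\<close> needs no rounding.\<close>

locale dense_C5_free =
  fixes V :: "'a set" and E :: "'a \<Rightarrow> 'a \<Rightarrow> 'a \<Rightarrow> bool"
  assumes finV: "finite V"
    and swap12: "E x y z \<Longrightarrow> E y x z"
    and swap23: "E x y z \<Longrightarrow> E x z y"
    and E_neq: "E x y z \<Longrightarrow> x \<noteq> y"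
    and E_in: "E x y z \<Longrightarrow> x \<in> V"
    and no_C5: "E a b c \<Longrightarrow> E b c d \<Longrightarrow> E c d e \<Longrightarrow> E d e a \<Longrightarrow> E e a b \<Longrightarrow> False"
    and dense: "E x y z \<Longrightarrow> card V \<le> 2 * card {v \<in> V. E x y v}"
begin

lemma E_comm: "E x y z \<longleftrightarrow> E y x z" "E x y z \<longleftrightarrow> E x z y"
  using swap12 swap23 by blast+

lemma E_irrefl [simp]: "\<not> E x x y" "\<not> E x y x" "\<not> E y x x"
  using E_neq E_comm by blast+

lemma E_inV: "E x y z \<Longrightarrow> x \<in> V \<and> y \<in> V \<and> z \<in> V"
  using E_in E_comm by blast

definition cd :: "'a \<Rightarrow> 'a \<Rightarrow> nat" where
  "cd x y = card {v \<in> V. E x y v}"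

definition K4 :: "'a \<Rightarrow> 'a \<Rightarrow> 'a \<Rightarrow> 'a \<Rightarrow> bool" where
  "K4 a b c d \<longleftrightarrow> E a b c \<and> E a b d \<and> E a c d \<and> E b c d"

text \<open>The possible links of a vertex \<open>v\<close> on a complete \<open>abcd\<close>: the triangle avoiding the first
  argument, or the star centred at it. The vertex \<open>a\<close> itself satisfies \<open>tri a b c d\<close>.\<close>

definition tri :: "'a \<Rightarrow> 'a \<Rightarrow> 'a \<Rightarrow> 'a \<Rightarrow> 'a \<Rightarrow> bool" where
  "tri a b c d v \<longleftrightarrow> E v b c \<and> E v b d \<and> E v c d \<and> \<not> E v a b \<and> \<not> E v a c \<and> \<not> E v a d"

definition star :: "'a \<Rightarrow> 'a \<Rightarrow> 'a \<Rightarrow> 'a \<Rightarrow> 'a \<Rightarrow> bool" where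
  "star a b c d v \<longleftrightarrow> \<not> E v b c \<and> \<not> E v b d \<and> \<not> E v c d \<and> E v a b \<and> E v a c \<and> E v a d"

section \<open>Existence of a complete quadruple\<close>

lemma cd_eq_sum: "cd x y = (\<Sum>v\<in>V. of_bool (E v x y))"
proof -
  have "{v \<in> V. E x y v} = V \<inter> {v. E v x y}" using E_comm by blast
  then show ?thesis using finV by (simp add: cd_def)
qed

lemma card_le_cd: "E x y z \<Longrightarrow> card V \<le> 2 * cd x y"
  using dense by (simp add: cd_def)

lemma sum_pair_cd:
  "(\<Sum>v\<in>V. of_bool (E v a b) + of_bool (E v a c) + of_bool (E v a d)
      + of_bool (E v b c) + of_bool (E v b d) + of_bool (E v c d))
   = cd a b + cd a c + cd a d + cd b c + cd b d + cd c d"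
  by (simp add: cd_eq_sum sum.distrib)

text \<open>Otherwise every vertex completes at most one pair of abc to an edge, and the three
  co-degrees sum to at most \<open>card V\<close>, although each is at least half of it.\<close>

lemma ex_K4_minus:
  assumes "E a b c"
  shows "\<exists>p x y z. E p x y \<and> E p x z \<and> E p y z"
proof (rule ccontr)
  assume "\<not> ?thesis"
  then have neg: "\<not> (E p x y \<and> E p x z \<and> E p y z)" for p x y z by blast
  have le1: "of_bool (E v a b) + of_bool (E v a c) + of_bool (E v b c) \<le> (1::nat)" for v
  proof -
    have "\<not> (E v a b \<and> E v a c)" "\<not> (E v a b \<and> E v b c)" "\<not> (E v a c \<and> E v b c)"
      using neg[of a b c v] neg[of b a c v] neg[of c a b v] assms E_comm by blast+
    then show ?thesis by auto
  qed
  have "cd a b + cd a c + cd b c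
      = (\<Sum>v\<in>V. of_bool (E v a b) + of_bool (E v a c) + of_bool (E v b c))"
    by (simp add: cd_eq_sum sum.distrib)
  also have "\<dots> \<le> (\<Sum>v\<in>V. 1)" by (rule sum_mono) (use le1 in blast)
  finally have "cd a b + cd a c + cd b c \<le> card V" by simp
  moreover have "card V \<le> 2 * cd a b" "card V \<le> 2 * cd a c" "card V \<le> 2 * cd b c"
    using assms card_le_cd E_comm by blast+
  moreover have "card V > 0" using assms E_inV finV card_gt_0_iff by blast
  ultimately show False by linarith
qed

lemma ex_K4:
  assumes "E a b c"
  shows "\<exists>a b c d. K4 a b c d"
proof (rule ccontr)
  assume neg: "\<not> ?thesis"
  obtain p x y z where e: "E p x y" "E p x z" "E p y z" using ex_K4_minus[OF assms] by blast
  let ?g = "\<lambda>v. of_bool (E v p x) + of_bool (E v p y) + of_bool (E v p z)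
      + of_bool (E v x y) + of_bool (E v x z) + of_bool (E v y z) :: nat"
  have tri_free: "\<not> (E v p u \<and> E v p w \<and> E v u w)" if "E p u w" for v u w
    using neg that E_comm unfolding K4_def by blast
  have path_free: "\<not> (E v p s \<and> E v s t \<and> E v t r)" if "E p s r" "E p r t" for v s t r
    using no_C5[of v s p r t] that E_comm by blast
  \<comment> \<open>Four edges on p, x, y, z form a 4-cycle or a triangle with a pendant edge.
    Either contains a triangle through p or a path through all four vertices starting at p. The
    former would give a complete quadruple, the latter a C5 through v.\<close>
  have le3: "?g v \<le> 3" for v
  proof -
    have "\<not> (E v p x \<and> E v p y \<and> E v x y)" "\<not> (E v p x \<and> E v p z \<and> E v x z)"
      "\<not> (E v p y \<and> E v p z \<and> E v y z)"
      using tri_free e by blast+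
    moreover have "\<not> (E v p x \<and> E v x y \<and> E v y z)" "\<not> (E v p x \<and> E v x z \<and> E v y z)"
      "\<not> (E v p y \<and> E v x y \<and> E v x z)" "\<not> (E v p y \<and> E v y z \<and> E v x z)"
      "\<not> (E v p z \<and> E v x z \<and> E v x y)" "\<not> (E v p z \<and> E v y z \<and> E v x y)"
      using path_free[of x z y v] path_free[of x y z v] path_free[of y z x v]
        path_free[of y x z v] path_free[of z y x v] path_free[of z x y v] e E_comm by blast+
    ultimately show ?thesis
      by (cases "E v p x"; cases "E v p y"; cases "E v p z"; cases "E v x y"; cases "E v x z"; cases "E v y z")
         simp_all
  qed
  \<comment> \<open>Only the pairs py, pz and yz can form an edge with x, and all three together
    would make pxyz complete. This one deficit makes the total strict.\<close>
  have "?g x < 3" using tri_free[OF e(3), of x] by auto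
  have "(\<Sum>v\<in>V. ?g v) < (\<Sum>v\<in>V. 3)"
  proof (rule sum_strict_mono_ex1[OF finV])
    show "\<exists>v\<in>V. ?g v < 3" using \<open>?g x < 3\<close> e E_inV by blast
  qed (use le3 in blast)
  then have "cd p x + cd p y + cd p z + cd x y + cd x z + cd y z < 3 * card V"
    unfolding sum_pair_cd by simp
  moreover have "card V \<le> 2 * cd p x" "card V \<le> 2 * cd p y" "card V \<le> 2 * cd p z"
    "card V \<le> 2 * cd x y" "card V \<le> 2 * cd x z" "card V \<le> 2 * cd y z"
    using e card_le_cd E_comm by blast+
  ultimately show False by linarith
qed

section \<open>Links on a complete quadruple\<close>

lemma K4_perm:
  assumes "K4 a b c d"
  shows "K4 b a c d" "K4 a c b d" "K4 a b d c"
  using assms E_comm unfolding K4_def by blast+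

text \<open>The path b-a-d-c in the link of v, together with the edges abc and bcd, is a C5 in the
  cyclic order v, a, b, c, d.\<close>

lemma K4_path_free: "K4 a b c d \<Longrightarrow> \<not> (E v a b \<and> E v a d \<and> E v c d)"
  using no_C5[of v a b c d] E_comm unfolding K4_def by blast

text \<open>These are all twelve Hamiltonian paths on four vertices, listed in one fixed notation so
  that the later case analysis over the six pairs is propositional.\<close>

lemma K4_paths:
  assumes "K4 a b c d"
  shows "\<not> (E v a b \<and> E v b c \<and> E v c d)" "\<not> (E v a b \<and> E v b d \<and> E v c d)"
    "\<not> (E v a c \<and> E v b c \<and> E v b d)" "\<not> (E v a c \<and> E v c d \<and> E v b d)"
    "\<not> (E v a d \<and> E v b d \<and> E v b c)" "\<not> (E v a d \<and> E v c d \<and> E v b c)"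
    "\<not> (E v a b \<and> E v a c \<and> E v c d)" "\<not> (E v a b \<and> E v a d \<and> E v c d)"
    "\<not> (E v a b \<and> E v a c \<and> E v b d)" "\<not> (E v a c \<and> E v a d \<and> E v b d)"
    "\<not> (E v a b \<and> E v a d \<and> E v b c)" "\<not> (E v a c \<and> E v a d \<and> E v b c)"
proof -
  have p: "K4 w x y z \<Longrightarrow> \<not> (E v w x \<and> E v w z \<and> E v y z)" for w x y z
    by (rule K4_path_free)
  note q = assms[unfolded K4_def]
  show "\<not> (E v a b \<and> E v b c \<and> E v c d)" using p[of b a d c] q E_comm unfolding K4_def by blast
  show "\<not> (E v a b \<and> E v b d \<and> E v c d)" using p[of b a c d] q E_comm unfolding K4_def by blast
  show "\<not> (E v a c \<and> E v b c \<and> E v b d)" using p[of c a d b] q E_comm unfolding K4_def by blast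
  show "\<not> (E v a c \<and> E v c d \<and> E v b d)" using p[of c a b d] q E_comm unfolding K4_def by blast
  show "\<not> (E v a d \<and> E v b d \<and> E v b c)" using p[of d a c b] q E_comm unfolding K4_def by blast
  show "\<not> (E v a d \<and> E v c d \<and> E v b c)" using p[of d a b c] q E_comm unfolding K4_def by blast
  show "\<not> (E v a b \<and> E v a c \<and> E v c d)" using p[of a b d c] q E_comm unfolding K4_def by blast
  show "\<not> (E v a b \<and> E v a d \<and> E v c d)" using p[of a b c d] q E_comm unfolding K4_def by blast
  show "\<not> (E v a b \<and> E v a c \<and> E v b d)" using p[of a c d b] q E_comm unfolding K4_def by blast
  show "\<not> (E v a c \<and> E v a d \<and> E v b d)" using p[of a c b d] q E_comm unfolding K4_def by blast
  show "\<not> (E v a b \<and> E v a d \<and> E v b c)" using p[of a d c b] q E_comm unfolding K4_def by blast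
  show "\<not> (E v a c \<and> E v a d \<and> E v b c)" using p[of a d b c] q E_comm unfolding K4_def by blast
qed

text \<open>Without a Hamiltonian path a graph on four vertices has at most three edges, so the six
  co-degrees sum to at most \<open>3 * card V\<close>. Each is at least half of
  \<open>card V\<close>; both claims are the equality case.\<close>

lemma K4_tight:
  assumes K: "K4 a b c d"
  shows "2 * cd a b = card V"
    and "v \<in> V \<Longrightarrow> of_bool (E v a b) + of_bool (E v a c) + of_bool (E v a d)
      + of_bool (E v b c) + of_bool (E v b d) + of_bool (E v c d) = (3::nat)"
proof -
  let ?g = "\<lambda>v. of_bool (E v a b) + of_bool (E v a c) + of_bool (E v a d)
      + of_bool (E v b c) + of_bool (E v b d) + of_bool (E v c d) :: nat"
  have le3: "?g v \<le> 3" for v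
    using K4_paths[OF K, of v]
    by (cases "E v a b"; cases "E v a c"; cases "E v a d"; cases "E v b c"; cases "E v b d"; cases "E v c d")
       simp_all
  have ge: "card V \<le> 2 * cd a b" "card V \<le> 2 * cd a c" "card V \<le> 2 * cd a d"
    "card V \<le> 2 * cd b c" "card V \<le> 2 * cd b d" "card V \<le> 2 * cd c d"
    using K card_le_cd E_comm unfolding K4_def by blast+
  have "(\<Sum>v\<in>V. ?g v) \<le> (\<Sum>v\<in>V. 3)" by (rule sum_mono) (use le3 in blast)
  then have le: "cd a b + cd a c + cd a d + cd b c + cd b d + cd c d \<le> 3 * card V"
    unfolding sum_pair_cd by simp
  show "2 * cd a b = card V" using le ge by linarith
  show "?g v = 3" if "v \<in> V"
  proof (rule ccontr)
    assume "?g v \<noteq> 3"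
    then have "?g v < 3" using le3[of v] by linarith
    then have "(\<Sum>v\<in>V. ?g v) < (\<Sum>v\<in>V. 3)"
      by (intro sum_strict_mono_ex1[OF finV]) (use le3 that in blast)+
    then have "cd a b + cd a c + cd a d + cd b c + cd b d + cd c d < 3 * card V"
      unfolding sum_pair_cd by simp
    then show False using ge by linarith
  qed
qed

text \<open>Three edges on four vertices form a path, a triangle or a star, and paths are
  excluded.\<close>

lemma K4_pattern:
  assumes "K4 a b c d" "v \<in> V"
  shows "tri a b c d v \<or> tri b a c d v \<or> tri c a b d v \<or> tri d a b c v \<or>
    star a b c d v \<or> star b a c d v \<or> star c a b d v \<or> star d a b c v"
proof -
  have comm: "E v b a = E v a b" "E v c a = E v a c" "E v d a = E v a d"
    "E v c b = E v b c" "E v d b = E v b d" "E v d c = E v c d"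
    using E_comm by blast+
  show ?thesis
    using K4_paths[OF assms(1), of v] K4_tight(2)[OF assms]
    unfolding tri_def star_def comm
    by (cases "E v a b"; cases "E v a c"; cases "E v a d"; cases "E v b c"; cases "E v b d"; cases "E v c d")
       simp_all
qed

section \<open>Counting triangle and star vertices\<close>

lemma E_pair_comm: "E v x y = E v y x"
  using E_comm by blast

definition tau :: "'a \<Rightarrow> 'a \<Rightarrow> 'a \<Rightarrow> 'a \<Rightarrow> nat" where
  "tau a b c d = card {v \<in> V. tri a b c d v}"

definition sigma :: "'a \<Rightarrow> 'a \<Rightarrow> 'a \<Rightarrow> 'a \<Rightarrow> nat" where
  "sigma a b c d = card {v \<in> V. star a b c d v}"

lemma tri_perm: "tri a c b d = tri a b c d" "tri a b d c = tri a b c d"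
  unfolding tri_def fun_eq_iff using E_pair_comm by blast+

lemma star_perm: "star a c b d = star a b c d" "star a b d c = star a b c d"
  unfolding star_def fun_eq_iff using E_pair_comm by blast+

lemma tau_perm: "tau a c b d = tau a b c d" "tau a b d c = tau a b c d"
  by (simp_all add: tau_def tri_perm)

lemma sigma_perm: "sigma a c b d = sigma a b c d" "sigma a b d c = sigma a b c d"
  by (simp_all add: sigma_def star_perm)

lemma starD:
  assumes "star a b c d v"
  shows "E v a b" "E v a c" "E v a d" "\<not> E v b c" "\<not> E v b d" "\<not> E v c d" "v \<in> V"
  using assms E_inV unfolding star_def by blast+

lemma triD:
  assumes "tri a b c d v"
  shows "E v b c" "E v b d" "E v c d" "\<not> E v a b" "\<not> E v a c" "\<not> E v a d" "v \<in> V"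
  using assms E_inV unfolding tri_def by blast+

lemma K4_tri_self:
  assumes "K4 a b c d"
  shows "tri a b c d a" "tri b a c d b" "tri c a b d c" "tri d a b c d"
  using assms E_comm unfolding K4_def tri_def by auto

text \<open>A triangle vertex can replace the vertex that its triangle avoids. Later proofs pass to
  the new quadruple and classify links there.\<close>

lemma tri_K4:
  assumes "K4 a b c d" "tri a b c d v"
  shows "K4 v b c d"
  using assms unfolding K4_def tri_def by blast

lemma card_eq_sum_of_bool: "card {v \<in> V. P v} = (\<Sum>v\<in>V. of_bool (P v))"
proof -
  have "{v \<in> V. P v} = V \<inter> {v. P v}" by blast
  then show ?thesis using finV by simp
qed

text \<open>The pair ab lies in the triangles avoiding c or d and in the stars centred at a or b,
  and in no other pattern.\<close>

lemma cd_eq_tau_sigma: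
  assumes "K4 a b c d"
  shows "cd a b = tau c a b d + tau d a b c + sigma a b c d + sigma b a c d"
proof -
  have "of_bool (E v a b) = (of_bool (tri c a b d v) + of_bool (tri d a b c v)
      + of_bool (star a b c d v) + of_bool (star b a c d v) :: nat)" if "v \<in> V" for v
  proof -
    have comm: "E v b a = E v a b" "E v c a = E v a c" "E v d a = E v a d"
      "E v c b = E v b c" "E v d b = E v b d" "E v d c = E v c d"
      using E_comm by blast+
    show ?thesis
      using K4_pattern[OF assms that]
      unfolding tri_def star_def comm
      by (cases "E v a b"; cases "E v a c"; cases "E v a d"; cases "E v b c"; cases "E v b d"; cases "E v c d")
         simp_all
  qed
  then have "(\<Sum>v\<in>V. of_bool (E v a b)) = (\<Sum>v\<in>V. of_bool (tri c a b d v) + of_bool (tri d a b c v)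
      + of_bool (star a b c d v) + of_bool (star b a c d v) :: nat)"
    by (intro sum.cong) auto
  then show ?thesis
    unfolding cd_eq_sum tau_def sigma_def card_eq_sum_of_bool sum.distrib .
qed

text \<open>The pairs ac and bc have equal co-degree by tightness; expanding both and cancelling the
  common terms leaves this balance.\<close>

lemma tau_sigma_diff:
  assumes K: "K4 a b c d"
  shows "tau a b c d + sigma b a c d = tau b a c d + sigma a b c d"
proof -
  have Kc: "K4 a c b d" "K4 b c a d" using K K4_perm by blast+
  have "2 * cd a c = 2 * cd b c" using Kc K4_tight(1) by metis
  then have "tau b a c d + tau d a b c + sigma a b c d + sigma c a b d
    = tau a b c d + tau d a b c + sigma b a c d + sigma c a b d"
    using cd_eq_tau_sigma[OF Kc(1)] cd_eq_tau_sigma[OF Kc(2)]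
    by (metis tau_perm sigma_perm mult_cancel_left zero_neq_numeral)
  then show ?thesis by linarith
qed

section \<open>Uniqueness of the star centre\<close>

lemma star_nbr:
  assumes K: "K4 a b c d" and x: "star a b c d x" and e: "E x b y"
  shows "tri a b c d y \<or> tri b a c d y \<or> star a b c d y \<or> star b a c d y"
proof -
  \<comment> \<open>Each pattern of y distinguishing c or d closes a C5 through the edge
    xby.\<close>
  have "\<not> tri c a b d y"
    using no_C5[of x b y d a] triD[of c a b d y] starD[OF x] e E_comm by blast
  moreover have "\<not> tri d a b c y"
    using no_C5[of x b y c a] triD[of d a b c y] starD[OF x] e E_comm by blast
  moreover have "\<not> star c a b d y"
    using no_C5[of y b x a c] starD[of c a b d y] starD[OF x] e E_comm by blast
  moreover have "\<not> star d a b c y"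
    using no_C5[of y b x a d] starD[of d a b c y] starD[OF x] e E_comm by blast
  ultimately show ?thesis using K4_pattern[OF K, of y] e E_inV by blast
qed

text \<open>The neighbours of the pair xb are counted by \<open>star_nbr\<close> and compared with
  the co-degree of ab. The 2 arises because b and x belong to the counted classes but are not
  neighbours of xb.\<close>

lemma star_tau_le:
  assumes K: "K4 a b c d" and x: "star a b c d x"
  shows "tau c a b d + tau d a b c + 2 \<le> tau a b c d + tau b a c d"
proof -
  let ?A = "{v \<in> V. tri a b c d v}" and ?B = "{v \<in> V. tri b a c d v}"
  let ?C = "{v \<in> V. star a b c d v}" and ?D = "{v \<in> V. star b a c d v}"
  have fin: "finite ?A" "finite ?B" "finite ?C" "finite ?D" using finV by auto
  have "{v \<in> V. E x b v} \<subseteq> ?A \<union> (?B - {b}) \<union> (?C - {x}) \<union> ?D"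
    using star_nbr[OF K x] by auto
  then have "cd x b \<le> card (?A \<union> (?B - {b}) \<union> (?C - {x}) \<union> ?D)"
    unfolding cd_def using fin by (intro card_mono) auto
  also have "\<dots> \<le> card ?A + card (?B - {b}) + card (?C - {x}) + card ?D"
    using card_Un_le[of "?A \<union> (?B - {b}) \<union> (?C - {x})" ?D]
      card_Un_le[of "?A \<union> (?B - {b})" "?C - {x}"] card_Un_le[of ?A "?B - {b}"] by linarith
  finally have 1: "cd x b \<le> card ?A + card (?B - {b}) + card (?C - {x}) + card ?D" .
  have b: "b \<in> ?B" using K4_tri_self(2)[OF K] triD(7) by blast
  have x': "x \<in> ?C" using x starD(7) by blast
  have "card ?B > 0" "card ?C > 0" using b x' fin card_gt_0_iff by blast+
  moreover have "card (?B - {b}) = card ?B - 1" "card (?C - {x}) = card ?C - 1"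
    using b x' by simp_all
  ultimately have "cd x b + 2 \<le> tau a b c d + tau b a c d + sigma a b c d + sigma b a c d"
    using 1 unfolding tau_def sigma_def by linarith
  moreover have "E x b a" using starD(1)[OF x] E_comm by blast
  then have "cd a b \<le> cd x b" using card_le_cd K4_tight(1)[OF K] by fastforce
  ultimately show ?thesis using cd_eq_tau_sigma[OF K] by linarith
qed

text \<open>Adding \<open>star_tau_le\<close> for the pairs ac and ad cancels the terms of c and
  d.\<close>

lemma star_tau_less:
  assumes K: "K4 a b c d" and x: "star a b c d x"
  shows "tau b a c d < tau a b c d"
proof -
  have "K4 a c b d" "K4 a d b c" "star a c b d x" "star a d b c x"
    using K x K4_perm star_perm by metis+
  then have "tau b a c d + tau d a b c + 2 \<le> tau a b c d + tau c a b d"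
    "tau b a c d + tau c a b d + 2 \<le> tau a b c d + tau d a b c"
    using star_tau_le[of a c b d x] star_tau_le[of a d b c x] tau_perm by metis+
  then show ?thesis by linarith
qed

lemma star_center_unique:
  assumes K: "K4 a b c d" and x: "star a b c d x"
  shows "\<not> star b a c d y" "\<not> star c a b d y" "\<not> star d a b c y"
proof -
  have uniq: "\<not> star b a c d y" if "K4 a b c d" "star a b c d x" for b c d
    using star_tau_less[OF that] star_tau_less[of b a c d y] K4_perm(1)[OF that(1)] by fastforce
  show "\<not> star b a c d y" using uniq K x by blast
  show "\<not> star c a b d y" using uniq[of c b d] K x K4_perm star_perm by metis
  show "\<not> star d a b c y" using uniq[of d b c] K x K4_perm star_perm by metis
qed

section \<open>Extending a star vertex to a complete quadruple\<close>

lemma star_tri_a: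
  assumes K: "K4 a b c d" and x: "star a b c d x" and z: "tri a b c d z"
  shows "star z b c d x"
proof -
  have "K4 z b c d" using tri_K4[OF K z] .
  \<comment> \<open>The star at z is the only pattern on zbcd that avoids bc, bd and cd.\<close>
  then show ?thesis using K4_pattern[of z b c d x] starD[OF x] E_pair_comm unfolding tri_def star_def by blast
qed

text \<open>The link of x contains ab and ad but not bd, and only the star at a does so.\<close>

lemma star_tri_c:
  assumes K: "K4 a b c d" and x: "star a b c d x" and z: "tri c a b d z"
  shows "star a b z d x"
proof -
  have "K4 a b z d" using tri_K4[OF _ z] K K4_perm by blast
  then show ?thesis using K4_pattern[of a b z d x] starD[OF x] E_pair_comm unfolding tri_def star_def by blast
qed

text \<open>Counting gives a second star vertex y with xby an edge, and then a triangle vertex a'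
  with a'bxy complete; finally a is shown to be able to replace a'.\<close>

lemma star_partner:
  assumes K: "K4 a b c d" and x: "star a b c d x"
  shows "\<exists>y. K4 a b x y"
proof -
  let ?A = "{v \<in> V. tri a b c d v}" and ?B = "{v \<in> V. tri b a c d v}"
  let ?C = "{v \<in> V. star a b c d v}"
  have fin: "finite ?A" "finite ?B" "finite ?C" using finV by auto
  have s0: "sigma b a c d = 0" "sigma c a b d = 0" "sigma d a b c = 0"
    using star_center_unique[OF K x] by (simp_all add: sigma_def)
  have Kp: "K4 b c a d" "K4 b d a c" using K K4_perm by blast+
  have t: "tau a b c d = tau b a c d + sigma a b c d"
    "tau c a b d = tau b a c d" "tau d a b c = tau b a c d"
    using tau_sigma_diff[OF K] tau_sigma_diff[OF Kp(1)] tau_sigma_diff[OF Kp(2)] s0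
    by (simp_all add: tau_perm sigma_perm)
  have cdab: "cd a b = 2 * tau b a c d + sigma a b c d"
    using cd_eq_tau_sigma[OF K] t s0 by simp
  have ge: "cd a b \<le> cd u w" if "E u w r" for u w r
    using card_le_cd[OF that] K4_tight(1)[OF K] by linarith
  have b: "b \<in> ?B" using K4_tri_self(2)[OF K] triD(7) by blast
  then have Bpos: "card ?B > 0" using fin card_gt_0_iff by blast
  have x': "x \<in> ?C" using x starD(7) by blast
  then have Cpos: "card ?C > 0" using fin card_gt_0_iff by blast
  \<comment> \<open>Without such a y, only the classes of a and b remain. They have
    \<open>cd a b\<close> elements in total, and b itself is not a neighbour of xb.\<close>
  have "\<exists>y. E x b y \<and> star a b c d y"
  proof (rule ccontr)
    assume neg: "\<not> ?thesis"
    have "{v \<in> V. E x b v} \<subseteq> ?A \<union> (?B - {b})"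
    proof
      fix v assume v: "v \<in> {v \<in> V. E x b v}"
      then have "tri a b c d v \<or> tri b a c d v"
        using neg star_nbr[OF K x] star_center_unique[OF K x] by blast
      then show "v \<in> ?A \<union> (?B - {b})" using v by auto
    qed
    then have "cd x b \<le> card (?A \<union> (?B - {b}))"
      unfolding cd_def using fin by (intro card_mono) auto
    also have "\<dots> \<le> card ?A + card (?B - {b})" by (rule card_Un_le)
    also have "\<dots> < card ?A + card ?B" using b fin Bpos by simp
    finally have "cd x b < 2 * tau b a c d + sigma a b c d" using t unfolding tau_def by linarith
    moreover have "E x b a" using starD(1)[OF x] E_comm by blast
    ultimately show False using ge cdab by fastforce
  qed
  then obtain y where y: "E x b y" "star a b c d y" by blast
  have exy: "E x y b" using y(1) E_comm by blast
  \<comment> \<open>Such a z would also form an edge with x and a, closing the C5 x, y, b, a,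
    z.\<close>
  have notc: "\<not> tri c a b d z" if "E x y z" for z
  proof
    assume z: "tri c a b d z"
    have "E x a z" using star_tri_c[OF K x z] starD(2) by blast
    then show False
      using no_C5[of x y b a z] exy that triD[OF z] starD[OF y(2)] E_comm by blast
  qed
  have notd: "\<not> tri d a b c z" if "E x y z" for z
  proof
    assume z: "tri d a b c z"
    have "K4 a b d c" "star a b d c x" using K x K4_perm star_perm by metis+
    then have "E x a z" using star_tri_c[of a b d c x z] z starD(2) by blast
    then show False
      using no_C5[of x y b a z] exy that triD[OF z] starD[OF y(2)] E_comm by blast
  qed
  have "\<exists>a'. E x y a' \<and> tri a b c d a'"
  proof (rule ccontr)
    assume neg: "\<not> ?thesis"
    have "v \<in> ?B \<union> (?C - {x})" if "v \<in> V" "E x y v" for v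
    proof -
      have "tri b a c d v \<or> star a b c d v"
        using neg K4_pattern[OF K that(1)] notc notd star_center_unique[OF K x] that(2) by blast
      then show ?thesis using that by auto
    qed
    then have "cd x y \<le> card (?B \<union> (?C - {x}))"
      unfolding cd_def using fin by (intro card_mono) auto
    also have "\<dots> \<le> card ?B + card (?C - {x})" by (rule card_Un_le)
    also have "\<dots> < card ?B + card ?C" using x' fin Cpos by simp
    finally have "cd x y < tau b a c d + sigma a b c d" unfolding tau_def sigma_def .
    then show False using ge[OF exy] cdab by linarith
  qed
  then obtain a' where a': "E x y a'" "tri a b c d a'" by blast
  have K': "K4 a' b x y"
    using star_tri_a[OF K x a'(2)] star_tri_a[OF K y(2) a'(2)] exy a'(1) E_comm
    unfolding star_def K4_def by blast
  \<comment> \<open>The vertex c is a star vertex centred at a', so a'bxy has no star centred at b.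
    The link of a contains bx and by, which leaves only the triangle bxy.\<close>
  have "star a' b x y c"
    using star_tri_a[OF K x a'(2)] star_tri_a[OF K y(2) a'(2)] triD[OF a'(2)]
      notc[of c] K4_tri_self(3)[OF K] E_comm
    unfolding star_def by blast
  then have "\<not> star b a' x y a" using star_center_unique[OF K'] by blast
  moreover have "E a b x" "E a b y" "a \<in> V" using starD[OF x] starD[OF y(2)] E_comm E_inV by blast+
  ultimately have "tri a' b x y a"
    using K4_pattern[OF K', of a] E_pair_comm unfolding tri_def star_def by blast
  then have "K4 a b x y" using tri_K4[OF K'] by blast
  then show ?thesis ..
qed

section \<open>An even co-degree\<close>

lemma K4_common_pair:
  assumes K: "K4 a b x y" and w: "E w a b" "E w a x" "E w b x"
  shows "tri y a b x w"
proof -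
  have comm: "E w b a = E w a b" "E w x a = E w a x" "E w y a = E w a y"
    "E w x b = E w b x" "E w y b = E w b y" "E w y x = E w x y"
    using E_comm by blast+
  show ?thesis
    using K4_pattern[OF K, of w] w E_inV[OF w(1)] unfolding tri_def star_def comm by simp
qed

text \<open>The graph \<open>K4 a b\<close> on the common neighbours of a and b meets the hypotheses
  of \<open>even_card_balanced_bipartite\<close>. Here \<open>partner\<close> excludes isolated
  vertices and \<open>no_star\<close> balances the sides.\<close>

lemma even_cd_if_no_stars_off_pair:
  assumes partner: "\<And>v. E a b v \<Longrightarrow> \<exists>y. K4 a b v y"
    and no_star: "\<And>x y v. K4 a b x y \<Longrightarrow> \<not> star x a b y v"
  shows "even (cd a b)"
proof -
  have sym: "K4 a b x y \<Longrightarrow> K4 a b y x" for x y using K4_perm by blast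
  have nbr: "{w. K4 a b x w} = {w \<in> V. tri y a b x w}" if "K4 a b x y" for x y
  proof -
    have "tri y a b x w" if "K4 a b x w" for w
      using K4_common_pair[OF \<open>K4 a b x y\<close>, of w] that E_comm unfolding K4_def by blast
    moreover have "K4 a b x w" if "tri y a b x w" for w
      using \<open>K4 a b x y\<close> that E_comm unfolding K4_def tri_def by blast
    ultimately show ?thesis using triD(7) by blast
  qed
  have "even (card {v \<in> V. E a b v})"
  proof (rule even_card_balanced_bipartite[where R = "K4 a b"])
    show "finite {v \<in> V. E a b v}" using finV by simp
    show "K4 a b y x" if "K4 a b x y" for x y using sym that .
    \<comment> \<open>Since z can replace x in abxy, its link contains ab but neither ax nor bx. The
      only such pattern on abxw is the triangle abw, so z can replace x there too.\<close>
    show "K4 a b z w" if xy: "K4 a b x y" and zy: "K4 a b z y" and xw: "K4 a b x w" for x y z w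
    proof -
      have "tri x a b y z" using nbr[OF sym[OF xy]] sym[OF zy] by blast
      note z = triD[OF this]
      have "tri x a b w z"
        using K4_pattern[OF xw z(7)] z E_pair_comm unfolding tri_def star_def by blast
      then show ?thesis using xw E_comm unfolding K4_def tri_def by blast
    qed
    \<comment> \<open>The neighbours of x are the vertices that can replace y, and conversely; the
      two numbers agree by \<open>tau_sigma_diff\<close> when no star is centred at x or y.\<close>
    show "card {w. K4 a b x w} = card {w. K4 a b y w}" if xy: "K4 a b x y" for x y
    proof -
      have "sigma x a b y = 0" "sigma y a b x = 0"
        using no_star[OF xy] no_star[OF sym[OF xy]] by (simp_all add: sigma_def)
      moreover have "K4 x y a b" using xy K4_perm by blast
      ultimately have "tau x y a b = tau y x a b"
        using tau_sigma_diff[of x y a b] by (simp add: sigma_perm)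
      then have "tau y a b x = tau x a b y" by (simp add: tau_perm)
      then show ?thesis unfolding nbr[OF xy] nbr[OF sym[OF xy]] tau_def .
    qed
    show False if "K4 a b x y" "K4 a b x w" "K4 a b y w" for x y w
      using nbr[OF that(1)] that(2,3) triD(4)[of y a b x w] E_comm unfolding K4_def by blast
    show "w \<in> {v \<in> V. E a b v}" if "K4 a b x w" for x w
      using that E_inV unfolding K4_def by blast
    show "\<exists>y. K4 a b x y" if "x \<in> {v \<in> V. E a b v}" for x using that partner by blast
  qed
  then show ?thesis by (simp add: cd_def)
qed

lemma ex_even_cd:
  assumes "E u v w"
  shows "\<exists>a b c. E a b c \<and> even (cd a b) \<and> 2 * cd a b = card V"
proof (cases "\<exists>a b c d x. K4 a b c d \<and> star a b c d x")
  case False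
  obtain a b c d where K: "K4 a b c d" using ex_K4[OF assms] by blast
  have "even (cd a b)"
  proof (rule even_cd_if_no_stars_off_pair)
    show "\<not> star x a b y v" if "K4 a b x y" for x y v
      using False that K4_perm by blast
    show "\<exists>y. K4 a b v y" if "E a b v" for v
    proof -
      have "\<not> star a b c d v" "\<not> star b a c d v" using False K K4_perm by blast+
      then have "tri c a b d v \<or> tri d a b c v"
        using K4_pattern[OF K, of v] that E_inV E_comm unfolding tri_def star_def by blast
      then show ?thesis using K E_comm unfolding K4_def tri_def by blast
    qed
  qed
  then show ?thesis using K K4_tight(1)[OF K] unfolding K4_def by blast
next
  case True
  then obtain a b c d x0 where K: "K4 a b c d" and x0: "star a b c d x0" by blast
  have pat: "tri c a b d v \<or> tri d a b c v \<or> star a b c d v" if "E a b v" for v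
    using K4_pattern[OF K, of v] that E_inV E_comm star_center_unique(1)[OF K x0]
    unfolding tri_def star_def by blast
  have tri_case: "star a b x y x0"
    if K: "K4 a b c d" and x0: "star a b c d x0" and xy: "K4 a b x y" and x: "tri c a b d x" for c d x y
    using K4_pattern[OF xy, of x0] starD[OF x0] starD[OF star_tri_c[OF K x0 x]] E_pair_comm
    unfolding tri_def star_def by blast
  have "even (cd a b)"
  proof (rule even_cd_if_no_stars_off_pair)
    show "\<exists>y. K4 a b v y" if "E a b v" for v
      using pat[OF that] star_partner[OF K] K E_comm unfolding K4_def tri_def by blast
    show "\<not> star x a b y v" if xy: "K4 a b x y" for x y v
    proof -
      have ex: "E a b x" "E a b y" "E x b y" using xy E_comm unfolding K4_def by blast+
      \<comment> \<open>One star centred at a on abxy excludes stars centred at x. If x can replace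
        c or d, then x0 remains such a star vertex; if x is itself a star vertex, then so is y, and
        c serves.\<close>
      have "\<exists>z. star a b x y z"
        using pat[OF ex(1)]
      proof (elim disjE)
        assume "tri c a b d x"
        then show ?thesis using tri_case[OF K x0 xy] by blast
      next
        assume "tri d a b c x"
        moreover have "K4 a b d c" "star a b d c x0" using K x0 K4_perm star_perm by metis+
        ultimately show ?thesis using tri_case[of d c, OF _ _ xy] by blast
      next
        assume x: "star a b c d x"
        have "\<not> tri c a b d y \<and> \<not> tri d a b c y"
          using star_nbr[OF K x ex(3)] E_pair_comm unfolding tri_def star_def by blast
        then have "star a b c d y" using pat[OF ex(2)] by blast
        note y = starD[OF this] and x = starD[OF x]
        have "E c a b" "E c a x" "E c a y" "\<not> E c b x" "c \<in> V"
          using K x y E_comm E_inV unfolding K4_def by blast+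
        then have "star a b x y c"
          using K4_pattern[OF xy, of c] E_pair_comm unfolding tri_def star_def by blast
        then show ?thesis ..
      qed
      then show ?thesis using star_center_unique(2)[OF xy] by blast
    qed
  qed
  then show ?thesis using K K4_tight(1)[OF K] unfolding K4_def by blast
qed

end

section \<open>Transfer to hypergraphs and the upper bound\<close>

lemma codegree_eq_card:
  assumes H: "three_graph H" and "x \<noteq> y"
  shows "codegree H {x, y} = card {v \<in> verts H. {x, y, v} \<in> edges H}"
proof -
  let ?N = "{v \<in> verts H. {x, y, v} \<in> edges H}"
  have ne: "v \<noteq> x \<and> v \<noteq> y" if "v \<in> ?N" for v
  proof (rule ccontr)
    assume "\<not> ?thesis"
    then have "card {x, y, v} \<le> 2" by (auto simp: card_insert_if)
    then show False using that H unfolding three_graph_def by fastforce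
  qed
  have "{e \<in> edges H. {x, y} \<subseteq> e} = (\<lambda>v. {x, y, v}) ` ?N"
  proof (intro equalityI subsetI)
    fix e assume e: "e \<in> {e \<in> edges H. {x, y} \<subseteq> e}"
    then have c: "card e = 3" "e \<subseteq> verts H" using H unfolding three_graph_def by auto
    then have "finite e" using card.infinite by fastforce
    then have "card (e - {x, y}) = 1" using e c \<open>x \<noteq> y\<close> by (simp add: card_Diff_subset)
    then obtain v where v: "e - {x, y} = {v}" using card_1_singletonE by blast
    then have "e = {x, y, v}" using e by blast
    then show "e \<in> (\<lambda>v. {x, y, v}) ` ?N" using e c by auto
  qed auto
  moreover have "inj_on (\<lambda>v. {x, y, v}) ?N"
  proof (rule inj_onI)
    fix v w assume vw: "v \<in> ?N" "w \<in> ?N" "{x, y, v} = {x, y, w}"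
    then have "v \<in> {x, y, w}" by blast
    then show "v = w" using ne[OF vw(1)] by blast
  qed
  ultimately show ?thesis unfolding codegree_def by (simp add: card_image)
qed

lemma edge_distinct:
  assumes "three_graph H" "{x, y, z} \<in> edges H"
  shows "x \<noteq> y" "x \<noteq> z" "y \<noteq> z"
proof -
  have "card {x, y, z} = 3" using assms unfolding three_graph_def by blast
  then show "x \<noteq> y" "x \<noteq> z" "y \<noteq> z" by (auto simp: card_insert_if split: if_splits)
qed

text \<open>Injectivity comes for free: any two of the five vertices lie in a common edge.\<close>

lemma contains_C5I:
  fixes a b c d e :: 'a
  assumes H: "three_graph H"
    and E: "{a, b, c} \<in> edges H" "{b, c, d} \<in> edges H" "{c, d, e} \<in> edges H"
      "{d, e, a} \<in> edges H" "{e, a, b} \<in> edges H"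
  shows "contains_copy H C5"
proof -
  have dist: "distinct [a, b, c, d, e]"
    using edge_distinct[OF H E(1)] edge_distinct[OF H E(2)] edge_distinct[OF H E(3)]
      edge_distinct[OF H E(4)] edge_distinct[OF H E(5)] by auto
  have inV: "{a, b, c, d, e} \<subseteq> verts H" using H E unfolding three_graph_def by blast
  define f where "f = (\<lambda>i::nat. if i = 0 then a else if i = 1 then b else if i = 2 then c
    else if i = 3 then d else e)"
  have f: "f 0 = a" "f 1 = b" "f (Suc 0) = b" "f 2 = c" "f 3 = d" "f 4 = e" by (simp_all add: f_def)
  have "inj_on f (verts C5)" using dist by (auto simp: C5_def inj_on_def f)
  moreover have "f ` verts C5 \<subseteq> verts H" using inV by (simp add: C5_def f)
  moreover have "\<forall>e'\<in>edges C5. f ` e' \<in> edges H" using E by (simp add: C5_def f)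
  ultimately show ?thesis unfolding contains_copy_def by blast
qed

lemma finite_pos_codegrees:
  assumes "three_graph H"
  shows "finite {codegree H S | S. S \<subseteq> verts H \<and> card S = 2 \<and> codegree H S \<noteq> 0}"
proof -
  have "finite (codegree H ` Pow (verts H))" using assms by (simp add: three_graph_def)
  then show ?thesis by (rule rev_finite_subset) auto
qed

lemma min_pos_codegree_le:
  assumes H: "three_graph H" and e: "{x, y, z} \<in> edges H"
  shows "min_pos_codegree H \<le> card {v \<in> verts H. {x, y, v} \<in> edges H}"
proof -
  note xy = edge_distinct(1)[OF H e]
  have fin: "finite (verts H)" using H by (simp add: three_graph_def)
  have "\<forall>e\<in>edges H. e \<subseteq> verts H" using H by (simp add: three_graph_def)
  then have in_V: "{x, y, z} \<subseteq> verts H" using e by (rule bspec)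
  have "card {v \<in> verts H. {x, y, v} \<in> edges H} > 0"
    unfolding card_gt_0_iff using fin in_V e by auto
  then have "codegree H {x, y} \<noteq> 0"
    using codegree_eq_card[OF H xy] by simp
  then have "min_pos_codegree H \<le> codegree H {x, y}"
    unfolding min_pos_codegree_def using in_V xy
    by (intro Min_le finite_pos_codegrees[OF H] CollectI exI[of _ "{x, y}"]) simp
  then show ?thesis using codegree_eq_card[OF H xy] by simp
qed

text \<open>\<open>ex_even_cd\<close> supplies a pair with even positive co-degree equal to half the
  order. The minimum cannot exceed it, so the assumed bound is attained.\<close>

lemma min_pos_codegree_C5_free:
  assumes H: "three_graph H" and ne: "edges H \<noteq> {}" and free: "\<not> contains_copy H C5"
    and ge: "card (verts H) \<le> 2 * min_pos_codegree H"
  shows "4 dvd card (verts H)" "2 * min_pos_codegree H = card (verts H)"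
proof -
  interpret dense_C5_free "verts H" "\<lambda>x y z. {x, y, z} \<in> edges H"
  proof
    show "finite (verts H)" using H by (simp add: three_graph_def)
    show "False" if "{a, b, c} \<in> edges H" "{b, c, d} \<in> edges H" "{c, d, e} \<in> edges H"
      "{d, e, a} \<in> edges H" "{e, a, b} \<in> edges H" for a b c d e
      using contains_C5I[OF H that] free by blast
    show "card (verts H) \<le> 2 * card {v \<in> verts H. {x, y, v} \<in> edges H}" if "{x, y, z} \<in> edges H" for x y z
      using min_pos_codegree_le[OF H that] ge by linarith
    show "x \<in> verts H" if "{x, y, z} \<in> edges H" for x y z
      using H that unfolding three_graph_def by blast
  qed (use edge_distinct[OF H] in \<open>auto simp: insert_commute\<close>)
  obtain e where "e \<in> edges H" using ne by blast
  moreover then have "card e = 3" using H unfolding three_graph_def by blast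
  ultimately obtain u v w where "{u, v, w} \<in> edges H" by (metis card_3_iff)
  then obtain a b c where abc: "{a, b, c} \<in> edges H" "even (cd a b)" "2 * cd a b = card (verts H)"
    using ex_even_cd by blast
  then show "4 dvd card (verts H)" by (auto elim!: evenE simp flip: abc(3))
  show "2 * min_pos_codegree H = card (verts H)"
    using min_pos_codegree_le[OF H abc(1)] abc(3) ge unfolding cd_def by linarith
qed

section \<open>The lower bound: residue classes modulo 4 as parts\<close>

definition K4_blowup :: "nat \<Rightarrow> nat hypergraph" where
  "K4_blowup n = ({..<n}, {e. e \<subseteq> {..<n} \<and> card e = 3 \<and> inj_on (\<lambda>x. x mod 4) e})"

lemma three_graph_K4_blowup: "three_graph (K4_blowup n)"
  by (auto simp: three_graph_def K4_blowup_def)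

lemma K4_blowup_edge_iff:
  "{x, y, z} \<in> edges (K4_blowup n) \<longleftrightarrow> x < n \<and> y < n \<and> z < n \<and>
     x mod 4 \<noteq> y mod 4 \<and> x mod 4 \<noteq> z mod 4 \<and> y mod 4 \<noteq> z mod 4"
proof (cases "x \<noteq> y \<and> x \<noteq> z \<and> y \<noteq> z")
  case True
  then show ?thesis by (simp add: K4_blowup_def) metis
next
  case False
  then have "card {x, y, z} \<noteq> 3" by (auto simp: card_insert_if)
  then show ?thesis using False by (simp add: K4_blowup_def) metis
qed

lemma K4_blowup_C5_free: "\<not> contains_copy (K4_blowup n) C5"
proof
  assume "contains_copy (K4_blowup n) C5"
  then obtain f where f: "\<forall>e\<in>edges C5. f ` e \<in> edges (K4_blowup n)"
    unfolding contains_copy_def by blast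
  define r where "r i = f i mod 4" for i
  \<comment> \<open>These are all ten pairs, so five residues modulo 4 would be distinct.\<close>
  have "r 0 \<noteq> r 1 \<and> r 0 \<noteq> r 2 \<and> r 1 \<noteq> r 2 \<and> r 1 \<noteq> r 3 \<and> r 2 \<noteq> r 3 \<and>
      r 2 \<noteq> r 4 \<and> r 3 \<noteq> r 4 \<and> r 3 \<noteq> r 0 \<and> r 4 \<noteq> r 0 \<and> r 4 \<noteq> r 1"
    using f by (simp add: C5_def K4_blowup_edge_iff r_def)
  then have "card {r 0, r 1, r 2, r 3, r 4} = 5" by (simp add: eq_commute)
  moreover have "{r 0, r 1, r 2, r 3, r 4} \<subseteq> {..<4}" by (simp add: r_def)
  then have "card {r 0, r 1, r 2, r 3, r 4} \<le> 4" using card_mono[of "{..<4}"] by fastforce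
  ultimately show False by simp
qed

text \<open>The elements 4j + i with j < m are counted. The second assumption says that the last of
  them is below n, without a natural subtraction at m = 0.\<close>

lemma card_residue_class:
  assumes "i < 4" "4 * m + i < n + 4"
  shows "m \<le> card {w. w < n \<and> w mod 4 = i}"
proof -
  have "(\<lambda>j. 4 * j + i) ` {..<m} \<subseteq> {w. w < n \<and> w mod 4 = i}" using assms by auto
  then have "card ((\<lambda>j. 4 * j + i) ` {..<m}) \<le> card {w. w < n \<and> w mod 4 = i}"
    by (intro card_mono) auto
  then show ?thesis by (simp add: card_image inj_on_def)
qed

lemma K4_blowup_codegree:
  fixes n :: nat
  assumes "x < n" "y < n" "x mod 4 \<noteq> y mod 4"
  shows "2 * (n div 4) + (if n mod 4 = 3 then 1 else 0)
    \<le> card {v \<in> verts (K4_blowup n). {x, y, v} \<in> edges (K4_blowup n)}"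
proof -
  let ?C = "\<lambda>i. {w. w < n \<and> w mod 4 = i}"
  have "card ({..<4} - {x mod 4, y mod 4}) = 2"
    using assms by (simp add: card_Diff_subset)
  then obtain i j where ij: "{..<4} - {x mod 4, y mod 4} = {i, j}" "i \<noteq> j"
    by (auto simp: card_2_iff)
  \<comment> \<open>The smaller of the two remaining residues is at most 2. If n mod 4 = 3, the
    classes 0, 1 and 2 have one more element than class 3, so class p provides the extra 1.\<close>
  define p where "p = min i j"
  define q where "q = max i j"
  have "{p, q} = {i, j}" "p < q" using ij(2) by (auto simp: p_def q_def)
  then have pq: "p < q" "q < 4" "{p, q} \<inter> {x mod 4, y mod 4} = {}" using ij(1) by auto
  have eq: "{v \<in> verts (K4_blowup n). {x, y, v} \<in> edges (K4_blowup n)} \<supseteq> ?C p \<union> ?C q"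
    using assms pq by (auto simp: K4_blowup_edge_iff) (simp_all add: K4_blowup_def)
  have "card (?C p \<union> ?C q) = card (?C p) + card (?C q)"
    using pq by (intro card_Un_disjoint) auto
  moreover have "n div 4 \<le> card (?C q)" using pq by (intro card_residue_class) auto
  moreover have "n div 4 + (if n mod 4 = 3 then 1 else 0) \<le> card (?C p)"
  proof (rule card_residue_class)
    define k where "k = n div 4"
    have n: "n = 4 * k + n mod 4" by (simp add: k_def)
    have "p \<le> 2" using pq(1,2) by simp
    then have "4 * (k + (if n mod 4 = 3 then 1 else 0)) + p < n + 4"
      using n by (cases "n mod 4 = 3") simp_all
    then show "4 * (n div 4 + (if n mod 4 = 3 then 1 else 0)) + p < n + 4" by (simp only: k_def)
  qed (use pq in simp)
  ultimately have "2 * (n div 4) + (if n mod 4 = 3 then 1 else 0) \<le> card (?C p \<union> ?C q)" by linarith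
  also have "\<dots> \<le> card {v \<in> verts (K4_blowup n). {x, y, v} \<in> edges (K4_blowup n)}"
    using eq by (intro card_mono) (auto simp: K4_blowup_def)
  finally show ?thesis .
qed

lemma min_pos_codegree_K4_blowup:
  assumes "n \<ge> 3"
  shows "edges (K4_blowup n) \<noteq> {}"
    and "2 * (n div 4) + (if n mod 4 = 3 then 1 else 0) \<le> min_pos_codegree (K4_blowup n)"
proof -
  let ?H = "K4_blowup n"
  note H = three_graph_K4_blowup[of n]
  have e: "{0, 1, 2} \<in> edges ?H" using assms unfolding K4_blowup_edge_iff by simp
  then show "edges ?H \<noteq> {}" by blast
  let ?M = "{codegree ?H S | S. S \<subseteq> verts ?H \<and> card S = 2 \<and> codegree ?H S \<noteq> 0}"
  \<comment> \<open>\<open>Min\<close> says nothing useful about an empty set, so the edge 012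
    provides a pair of positive co-degree.\<close>
  have "2 \<in> {v \<in> verts ?H. {0, 1, v} \<in> edges ?H}" "finite (verts ?H)"
    using e assms by (simp_all add: K4_blowup_def)
  then have "card {v \<in> verts ?H. {0, 1, v} \<in> edges ?H} \<noteq> 0" by auto
  then have "codegree ?H {0, 1} \<noteq> 0"
    using codegree_eq_card[OF H, of 0 1] by simp
  then have "?M \<noteq> {}" using assms by (auto simp: K4_blowup_def intro!: exI[of _ "{0, 1}"])
  moreover have "2 * (n div 4) + (if n mod 4 = 3 then 1 else 0) \<le> m" if "m \<in> ?M" for m
  proof -
    obtain S where S: "m = codegree ?H S" "card S = 2" "codegree ?H S \<noteq> 0"
      using \<open>m \<in> ?M\<close> by blast
    then obtain x y where xy: "S = {x, y}" "x \<noteq> y" by (auto simp: card_2_iff)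
    then have "card {v \<in> verts ?H. {x, y, v} \<in> edges ?H} \<noteq> 0"
      using S codegree_eq_card[OF H] by simp
    then have "{v \<in> verts ?H. {x, y, v} \<in> edges ?H} \<noteq> {}" by (metis card.empty)
    then obtain v where "{x, y, v} \<in> edges ?H" by blast
    then have "x < n" "y < n" "x mod 4 \<noteq> y mod 4" unfolding K4_blowup_edge_iff by simp_all
    from K4_blowup_codegree[OF this] show ?thesis using S xy codegree_eq_card[OF H] by simp
  qed
  ultimately show "2 * (n div 4) + (if n mod 4 = 3 then 1 else 0) \<le> min_pos_codegree ?H"
    unfolding min_pos_codegree_def using finite_pos_codegrees[OF H] by (intro Min.boundedI) auto
qed

section \<open>The exact value\<close>

lemma pos_codegree_turan_C5:
  assumes "n \<ge> 3"
  shows "pos_codegree_turan n C5 = 2 * (n div 4) + (if n mod 4 = 3 then 1 else 0)" (is "_ = ?m")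
proof -
  let ?M = "{min_pos_codegree H | H :: nat hypergraph.
            three_graph H \<and> card (verts H) = n \<and> edges H \<noteq> {} \<and> \<not> contains_copy H C5}"
  have le: "m \<le> ?m" if "m \<in> ?M" for m
  proof (rule ccontr)
    assume "\<not> m \<le> ?m"
    obtain H :: "nat hypergraph" where H: "m = min_pos_codegree H" "three_graph H"
      "card (verts H) = n" "edges H \<noteq> {}" "\<not> contains_copy H C5" using \<open>m \<in> ?M\<close> by blast
    \<comment> \<open>The value \<open>?m\<close> is the largest integer below n/2, except that it
      equals n/2 when 4 divides n. A larger m is therefore at least n/2, which forces 4 to divide n
      and m = n/2 = \<open>?m\<close>.\<close>
    have "n \<le> 2 * m" using \<open>\<not> m \<le> ?m\<close> by (auto split: if_splits) presburger+
    then have "4 dvd n" "2 * m = n" using min_pos_codegree_C5_free[of H] H by auto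
    then show False using \<open>\<not> m \<le> ?m\<close> by auto
  qed
  have "card (verts (K4_blowup n)) = n" by (simp add: K4_blowup_def)
  then have in_M: "min_pos_codegree (K4_blowup n) \<in> ?M"
    using three_graph_K4_blowup K4_blowup_C5_free min_pos_codegree_K4_blowup(1)[OF assms] by blast
  have "min_pos_codegree (K4_blowup n) = ?m"
    using le[OF in_M] min_pos_codegree_K4_blowup(2)[OF assms] by (rule antisym)
  then have mem: "?m \<in> ?M" using in_M by (rule subst)
  \<comment> \<open>There are infinitely many such hypergraphs on natural numbers; the upper bound
    is what makes the set of values finite, as \<open>Max\<close> requires.\<close>
  have fin: "finite ?M"
    by (rule finite_subset[of _ "{..?m}"]) (use le in \<open>simp_all add: subset_eq\<close>)
  show ?thesis unfolding pos_codegree_turan_def by (rule Max_eqI[OF fin le mem])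
qed

theorem theorem2:
  fixes n k :: nat
  assumes "n \<ge> 6" and "k = n div 4"
  shows "(n mod 4 \<in> {0, 1, 2} \<longrightarrow> pos_codegree_turan n C5 = 2 * k) \<and>
         (n mod 4 = 3 \<longrightarrow> pos_codegree_turan n C5 = 2 * k + 1)"
proof -
  have "pos_codegree_turan n C5 = 2 * k + (if n mod 4 = 3 then 1 else 0)"
    unfolding assms(2) by (rule pos_codegree_turan_C5) (use assms(1) in linarith)
  moreover have "n mod 4 \<noteq> 3" if "n mod 4 \<in> {0, 1, 2}" using that by force
  ultimately show ?thesis by presburger
qed

end
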